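(* Let $P$ be a full dimensional normal lattice polytope, $A$ its set of faces, and $X_P\subseteq\mathbb P(V)$ the associated embedded toric variety. There is a bijection between the set of equivalence classes of combinatorial Seshadri stratifications on $X_P$ and the set of triangulations $\mathcal T$ of $P$ indexed by flags of faces in $A$.
   Context: Toric variety. $\mathbb K$ is an algebraically closed field of characteristic zero, $T\simeq(\mathbb K^* )^n$ is a torus with character lattice $M$, $M_{\mathbb Q}=M\otimes_{\mathbb Z}\mathbb Q$, $M_{\mathbb R}=M\otimes_{\mathbb Z}\mathbb R$. $P\subseteq M_{\mathbb R}$ is a full dimensional normal lattice polytope, $\Lambda=P\cap M$, $V=\mathbb K^\Lambda$ with standard basis $\{e_\chi\}_{\chi\in\Lambda}$ and dual coordinates $x_\chi$. $X_P\subseteq\mathbb P(V)$ is the Zariski closure of the image of $T\to\mathbb P(V)$, $t\mapsto[\sum_{\chi\in\Lambda}\chi(t)e_\chi]$; $\hat X_P\subseteq V$ is its affine cone and $\mathbb K[\hat X_P]$ the coordinate ring of the cone (the homogeneous coordinate ring of $X_P$), graded by degree. $\hat T=\mathbb K^*\times T$, with character lattice $\hat M=\mathbb Z\oplus M$, acts on $V$ by $(c,t)\cdot e_\chi=c\chi(t)e_\chi$ and on functions by $(\hat t\cdot g)(x)=g(\hat t^{-1}x)$; so $x_\chi|_{\hat X_P}$ has weight $(-1,-\chi)$. A (nonzero) $\hat T$-eigenfunction $g$ is homogeneous and its weight $\lambda_g$ has first entry $-\deg g$. $M_{\mathbb R}$ is identified with $\{1\}\times M_{\mathbb R}\subset\mathbb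 R\oplus M_{\mathbb R}$. Stratifications. $A$ is the set of (nonempty) faces of $P$, including $P$, ordered by inclusion; $\sigma^o$ is the relative interior of $\sigma$. For $\sigma\in A$, $X_\sigma\subseteq X_P$ is the Zariski closure of the $T$-orbit $O_\sigma=\{[\sum_{\chi\in\Lambda\cap\sigma}\chi(t)e_\chi]\mid t\in T\}$. A combinatorial Seshadri stratification on $X_P$ is a collection $(X_\sigma,f_\sigma)_{\sigma\in A}$ where each $f_\sigma\in\mathbb K[\hat X_P]\setminus\{0\}$ is a $\hat T$-eigenfunction with $\deg f_\sigma\ge1$ whose $\hat T$-weight $\mu_\sigma$ satisfies $\frac{-\mu_\sigma}{\deg f_\sigma}\in\sigma^o$. Two combinatorial Seshadri stratifications $(X_\sigma,f_\sigma)_{\sigma\in A}$, $(X_\sigma,h_\sigma)_{\sigma\in A}$ are equivalent if, for all $\sigma\in A$, the points $-\mathrm{wt}(f_\sigma)/\deg f_\sigma$ and $-\mathrm{wt}(h_\sigma)/\deg h_\sigma$ coincide. Triangulations. $\mathcal F(A)$ is the set of flags, i.e. of totally ordered subsets of $A$. A triangulation of $P$ indexed by flags of faces is a triangulation $\mathcal T=(\Delta_C)_{C\in\mathcal F(A)}$ of $P$ with rational vertices and simplices indexed by $\mathcal F(A)$ such that (1) the relative interior of every face $\sigma\in A$ contains exactly one vertex $\mathbf v_\sigma\in M_{\mathbb Q}$ of $\mathcal T$, and (2) $\Delta_C$ is the convex hull of $\{\mathbf v_\sigma\mid\sigma\in C\}$. *)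

theory Defs
  imports "HOL-Analysis.Analysis" "HOL-Library.Poly_Mapping"
    "HOL-Computational_Algebra.Polynomial"
begin

text \<open>
  The torus is \<open>T = (K\<^sup>*)\<^sup>n\<close> with \<open>n = CARD('n)\<close>, its character lattice is
  \<open>M = int ^ 'n\<close>, and \<open>M\<^sub>R = real ^ 'n\<close>.
\<close>

definition of_lat :: "int ^ 'n \<Rightarrow> real ^ 'n" where
  "of_lat \<xi> = (\<chi> i. real_of_int (\<xi> $ i))"

definition rational_point :: "real ^ 'n \<Rightarrow> bool" where
  "rational_point v \<longleftrightarrow> (\<forall>i. v $ i \<in> \<rat>)"

subsection \<open>Polytopes\<close>

definition lattice_polytope :: "(real ^ 'n) set \<Rightarrow> bool" where
  "lattice_polytope P \<longleftrightarrow> (\<exists>S. finite S \<and> P = convex hull (of_lat ` S))"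

definition full_dimensional :: "(real ^ 'n::finite) set \<Rightarrow> bool" where
  "full_dimensional P \<longleftrightarrow> aff_dim P = int CARD('n)"

text \<open>\<open>lattice_points k P\<close> is \<open>kP \<inter> M\<close>.\<close>

definition lattice_points :: "nat \<Rightarrow> (real ^ 'n) set \<Rightarrow> (int ^ 'n) set" where
  "lattice_points k P = {\<xi>. of_lat \<xi> \<in> (\<lambda>x. real k *\<^sub>R x) ` P}"

text \<open>Normality is taken with respect to the full lattice \<open>M\<close>:
  \<open>(kP \<inter> M) + (lP \<inter> M) = (k+l)P \<inter> M\<close>.\<close>

definition normal_polytope :: "(real ^ 'n) set \<Rightarrow> bool" where
  "normal_polytope P \<longleftrightarrow>
     (\<forall>k l. {\<xi> + \<psi> | \<xi> \<psi>. \<xi> \<in> lattice_points k P \<and> \<psi> \<in> lattice_points l P}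
            = lattice_points (k + l) P)"

definition Lam :: "(real ^ 'n) set \<Rightarrow> (int ^ 'n) set" where
  "Lam P = {\<xi>. of_lat \<xi> \<in> P}"

definition faces :: "(real ^ 'n) set \<Rightarrow> (real ^ 'n) set set" where
  "faces P = {\<sigma>. \<sigma> face_of P \<and> \<sigma> \<noteq> {}}"

text \<open>The empty flag is included. It indexes the empty simplex, which a nonempty
  \<^const>\<open>simplicial_complex\<close>, being closed under faces, always contains.\<close>

definition flags :: "(real ^ 'n) set \<Rightarrow> (real ^ 'n) set set set" where
  "flags P = chains (faces P)"

subsection \<open>The torus and its characters\<close>

definition torus :: "('k::field ^ 'n) set" where
  "torus = {t. \<forall>i. t $ i \<noteq> 0}"

definition character :: "int ^ 'n \<Rightarrow> 'k::field ^ 'n::finite \<Rightarrow> 'k" where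
  "character \<xi> t = (\<Prod>i\<in>UNIV. t $ i powi \<xi> $ i)"

definition ext_torus :: "('k::field \<times> ('k ^ 'n)) set" where
  "ext_torus = (UNIV - {0}) \<times> torus"

fun ext_inverse :: "'k::field \<times> ('k ^ 'n) \<Rightarrow> 'k \<times> ('k ^ 'n)" where
  "ext_inverse (c, t) = (inverse c, \<chi> i. inverse (t $ i))"

fun ext_character :: "int \<times> (int ^ 'n) \<Rightarrow> 'k::field \<times> ('k ^ 'n::finite) \<Rightarrow> 'k" where
  "ext_character (a, \<xi>) (c, t) = c powi a * character \<xi> t"

subsection \<open>Projective toric varieties\<close>

text \<open>A vector of \<open>V = K\<^sup>\<Lambda>\<close> is a function on \<open>M\<close> vanishing outside \<open>\<Lambda>\<close>.\<close>

type_synonym ('k, 'n) vect = "int ^ 'n \<Rightarrow> 'k"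

definition vspace :: "(real ^ 'n) set \<Rightarrow> ('k::field, 'n) vect set" where
  "vspace P = {v. \<forall>\<xi>. \<xi> \<notin> Lam P \<longrightarrow> v \<xi> = 0}"

definition proj_point :: "('k::field, 'n) vect \<Rightarrow> ('k, 'n) vect set" where
  "proj_point v = {(\<lambda>\<xi>. c * v \<xi>) | c. c \<noteq> 0}"

definition proj_space :: "(real ^ 'n) set \<Rightarrow> ('k::field, 'n) vect set set" where
  "proj_space P = proj_point ` (vspace P - {\<lambda>_. 0})"

text \<open>Polynomials in the coordinates \<open>x\<^sub>\<xi>\<close>: finitely supported maps from
  monomials (exponent vectors) to coefficients.\<close>

type_synonym ('k, 'n) polyn = "((int ^ 'n) \<Rightarrow>\<^sub>0 nat) \<Rightarrow>\<^sub>0 'k"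

definition polynomials :: "(real ^ 'n) set \<Rightarrow> ('k::field, 'n) polyn set" where
  "polynomials P = {p. \<forall>m \<in> Poly_Mapping.keys p. Poly_Mapping.keys m \<subseteq> Lam P}"

definition homogeneous_polynomials ::
    "(real ^ 'n) set \<Rightarrow> nat \<Rightarrow> ('k::field, 'n) polyn set" where
  "homogeneous_polynomials P d =
     {p \<in> polynomials P. \<forall>m \<in> Poly_Mapping.keys p.
        (\<Sum>\<xi>\<in>Poly_Mapping.keys m. Poly_Mapping.lookup m \<xi>) = d}"

definition peval :: "('k::field, 'n) polyn \<Rightarrow> ('k, 'n) vect \<Rightarrow> 'k" where
  "peval p x = (\<Sum>m\<in>Poly_Mapping.keys p. Poly_Mapping.lookup p m *
     (\<Prod>\<xi>\<in>Poly_Mapping.keys m. x \<xi> ^ Poly_Mapping.lookup m \<xi>))"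

definition zariski_closed :: "(real ^ 'n) set \<Rightarrow> ('k::field, 'n) vect set set \<Rightarrow> bool" where
  "zariski_closed P Z \<longleftrightarrow>
     (\<exists>S \<subseteq> (\<Union>d. homogeneous_polynomials P d).
        Z = {l \<in> proj_space P. \<forall>p\<in>S. \<forall>x\<in>l. peval p x = 0})"

definition zariski_closure ::
    "(real ^ 'n) set \<Rightarrow> ('k::field, 'n) vect set set \<Rightarrow> ('k, 'n) vect set set" where
  "zariski_closure P Y = \<Inter> {Z. zariski_closed P Z \<and> Y \<subseteq> Z}"

text \<open>\<open>O\<^sub>\<sigma>\<close>, the orbit of \<open>[\<Sum>\<^sub>\<xi> e\<^sub>\<xi>]\<close> with \<open>\<xi>\<close> ranging over \<open>\<Lambda> \<inter> \<sigma>\<close>.\<close>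

definition orbit :: "(real ^ 'n) set \<Rightarrow> (real ^ 'n::finite) set \<Rightarrow> ('k::field, 'n) vect set set"
  where
  "orbit P \<sigma> = {proj_point (\<lambda>\<xi>. if \<xi> \<in> Lam P \<and> of_lat \<xi> \<in> \<sigma> then character \<xi> t else 0) | t.
                 t \<in> torus}"

definition X_face :: "(real ^ 'n) set \<Rightarrow> (real ^ 'n::finite) set \<Rightarrow> ('k::field, 'n) vect set set"
  where
  "X_face P \<sigma> = zariski_closure P (orbit P \<sigma>)"

definition toric_variety :: "(real ^ 'n::finite) set \<Rightarrow> ('k::field, 'n) vect set set" where
  "toric_variety P = X_face P P"

definition affine_cone :: "(real ^ 'n::finite) set \<Rightarrow> ('k::field, 'n) vect set" where
  "affine_cone P = {v \<in> vspace P. v = (\<lambda>_. 0) \<or> proj_point v \<in> toric_variety P}"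

text \<open>The quotient of \<open>K[V]\<close> by the vanishing ideal of the affine cone is the ring of polynomial
  functions on the cone. Its elements are represented as extensional
  functions, so that equality in the ring is equality.\<close>

type_synonym ('k, 'n) cfun = "('k, 'n) vect \<Rightarrow> 'k"

definition coord_ring :: "(real ^ 'n::finite) set \<Rightarrow> ('k::field, 'n) cfun set" where
  "coord_ring P = {restrict (peval p) (affine_cone P) | p. p \<in> polynomials P}"

definition coord_zero :: "(real ^ 'n::finite) set \<Rightarrow> ('k::field, 'n) cfun" where
  "coord_zero P = restrict (\<lambda>_. 0) (affine_cone P)"

definition graded_piece :: "(real ^ 'n::finite) set \<Rightarrow> nat \<Rightarrow> ('k::field, 'n) cfun set" where
  "graded_piece P d = {restrict (peval p) (affine_cone P) | p. p \<in> homogeneous_polynomials P d}"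

text \<open>Determined only for nonzero homogeneous elements, in particular for eigenfunctions of the
  extended torus.\<close>

definition deg :: "(real ^ 'n::finite) set \<Rightarrow> ('k::field, 'n) cfun \<Rightarrow> nat" where
  "deg P g = (THE d. g \<in> graded_piece P d)"

subsection \<open>Eigenfunctions and weights\<close>

fun act_vect :: "'k::field \<times> ('k ^ 'n::finite) \<Rightarrow> ('k, 'n) vect \<Rightarrow> ('k, 'n) vect" where
  "act_vect (c, t) v = (\<lambda>\<xi>. c * character \<xi> t * v \<xi>)"

definition act_fun ::
    "(real ^ 'n::finite) set \<Rightarrow> 'k::field \<times> ('k ^ 'n) \<Rightarrow> ('k, 'n) cfun \<Rightarrow> ('k, 'n) cfun" where
  "act_fun P s g = restrict (\<lambda>x. g (act_vect (ext_inverse s) x)) (affine_cone P)"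

definition has_weight ::
    "(real ^ 'n::finite) set \<Rightarrow> ('k::field, 'n) cfun \<Rightarrow> int \<times> (int ^ 'n) \<Rightarrow> bool" where
  "has_weight P g \<mu> \<longleftrightarrow>
     (\<forall>s \<in> ext_torus. act_fun P s g = restrict (\<lambda>x. ext_character \<mu> s * g x) (affine_cone P))"

definition eigenfunction :: "(real ^ 'n::finite) set \<Rightarrow> ('k::field, 'n) cfun \<Rightarrow> bool" where
  "eigenfunction P g \<longleftrightarrow> g \<in> coord_ring P \<and> g \<noteq> coord_zero P \<and> (\<exists>\<mu>. has_weight P g \<mu>)"

definition weight :: "(real ^ 'n::finite) set \<Rightarrow> ('k::field, 'n) cfun \<Rightarrow> int \<times> (int ^ 'n)" where
  "weight P g = (THE \<mu>. has_weight P g \<mu>)"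

text \<open>The point \<open>- wt(g) / deg g\<close> of \<open>R \<oplus> M\<^sub>R\<close>.\<close>

definition weight_point :: "(real ^ 'n::finite) set \<Rightarrow> ('k::field, 'n) cfun \<Rightarrow> real \<times> (real ^ 'n)"
  where
  "weight_point P g =
     (1 / real (deg P g)) *\<^sub>R (- map_prod real_of_int of_lat (weight P g))"

subsection \<open>Combinatorial Seshadri stratifications\<close>

type_synonym ('k, 'n) stratification =
  "(real ^ 'n) set \<Rightarrow> ('k, 'n) vect set set \<times> ('k, 'n) cfun"

definition seshadri_stratifications ::
    "(real ^ 'n::finite) set \<Rightarrow> ('k::field, 'n) stratification set" where
  "seshadri_stratifications P =
     {s \<in> extensional (faces P). \<forall>\<sigma> \<in> faces P. \<exists>f.
        s \<sigma> = (X_face P \<sigma>, f) \<and> eigenfunction P f \<and> deg P f \<ge> 1 \<and>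
        weight_point P f \<in> {1} \<times> rel_interior \<sigma>}"

definition stratification_equiv ::
    "(real ^ 'n::finite) set \<Rightarrow> (('k::field, 'n) stratification \<times> ('k, 'n) stratification) set"
  where
  "stratification_equiv P =
     {(s, s'). s \<in> seshadri_stratifications P \<and> s' \<in> seshadri_stratifications P \<and>
        (\<forall>\<sigma> \<in> faces P. weight_point P (snd (s \<sigma>)) = weight_point P (snd (s' \<sigma>)))}"

lemma equiv_stratification_equiv:
  "equiv (seshadri_stratifications P) (stratification_equiv P)"
  by (rule equivI) (auto simp: stratification_equiv_def refl_on_def sym_def trans_def)

subsection \<open>Triangulations indexed by flags of faces\<close>

definition complex_vertices :: "(real ^ 'n) set set \<Rightarrow> (real ^ 'n) set" where
  "complex_vertices \<T> = {v. \<exists>\<Delta> \<in> \<T>. v extreme_point_of \<Delta>}"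

definition triangulation_of :: "(real ^ 'n) set \<Rightarrow> (real ^ 'n) set set \<Rightarrow> bool" where
  "triangulation_of P \<T> \<longleftrightarrow> simplicial_complex \<T> \<and> \<Union>\<T> = P"

definition face_vertex :: "(real ^ 'n) set set \<Rightarrow> (real ^ 'n) set \<Rightarrow> real ^ 'n" where
  "face_vertex \<T> \<sigma> = (THE v. v \<in> complex_vertices \<T> \<and> v \<in> rel_interior \<sigma>)"

definition flag_triangulations ::
    "(real ^ 'n) set \<Rightarrow> ((real ^ 'n) set set \<Rightarrow> (real ^ 'n) set) set" where
  "flag_triangulations P =
     {\<Delta> \<in> extensional (flags P). let \<T> = \<Delta> ` flags P in
        triangulation_of P \<T> \<and>
        (\<forall>v \<in> complex_vertices \<T>. rational_point v) \<and>
        (\<forall>\<sigma> \<in> faces P. \<exists>!v. v \<in> complex_vertices \<T> \<and> v \<in> rel_interior \<sigma>) \<and>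
        (\<forall>C \<in> flags P. \<Delta> C = convex hull (face_vertex \<T> ` C))}"

end

theory Submission
  imports Defs
begin

text \<open>
  Both sets of the theorem are parametrised by the same data: a choice of one rational point
  \<open>v \<sigma>\<close> in the relative interior of every face \<open>\<sigma>\<close> of \<open>P\<close>.

  A stratification gives such a choice by \<open>\<sigma> \<mapsto> - wt(f\<^sub>\<sigma>) / deg f\<^sub>\<sigma>\<close>, and two stratifications are
  equivalent exactly if they give the same choice. Every choice arises
  (\<open>rational_point_eigenfunction\<close>): write \<open>v \<sigma> = \<mu> / d\<close> with \<open>\<mu>\<close> a lattice point of \<open>dP\<close>. By
  normality \<open>\<mu>\<close> is a sum of \<open>d\<close> lattice points of \<open>P\<close>, and the product of the corresponding \<open>d\<close>
  coordinates is an eigenfunction of degree \<open>d\<close> and weight \<open>(-d, -\<mu>)\<close>. This product is not zero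
  on the cone, because it takes the value 1 at the point whose coordinates are all 1. For the action
  on functions on the cone to be computed this way, the cone has to be stable under the torus
  (\<open>affine_cone_act\<close>).

  A triangulation indexed by flags is determined by its vertices \<open>v \<sigma>\<close>, since \<open>\<Delta>\<^sub>C\<close> is the convex hull
  of the \<open>v \<sigma>\<close> with \<open>\<sigma> \<in> C\<close>. Conversely, for every choice of points these hulls triangulate \<open>P\<close>
  (\<open>flag_hulls_triangulation\<close>), as in the barycentric subdivision: each face \<open>\<sigma>\<close> is the cone with
  apex \<open>v \<sigma>\<close> over its relative boundary, which is the union of the smaller faces. Going up
  through the faces, this yields that the vertices of a flag are affinely independent, that the
  hulls cover \<open>P\<close>, and that two hulls meet in the hull of the common part of their flags
  (\<open>flag_hull_Int\<close>).
\<close>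

section \<open>Flags of faces\<close>

lemma faces_finite: "polytope P \<Longrightarrow> finite (faces P)"
  unfolding faces_def by (rule finite_subset[OF _ finite_polytope_faces]) auto

lemma faces_subset_face_of:
  assumes "\<sigma> \<in> faces P" "\<tau> \<in> faces P" "\<tau> \<subseteq> \<sigma>"
  shows "\<tau> face_of \<sigma>"
  using assms face_of_subset[of \<tau> P \<sigma>] unfolding faces_def by (auto dest: face_of_imp_subset)

lemma faces_trans:
  assumes "\<sigma> \<in> faces P" "\<tau> face_of \<sigma>" "\<tau> \<noteq> {}"
  shows "\<tau> \<in> faces P"
  using assms unfolding faces_def by (auto intro: face_of_trans)

lemma faces_eqI:
  assumes "\<sigma> \<in> faces P" "\<tau> \<in> faces P" "x \<in> rel_interior \<sigma>" "x \<in> rel_interior \<tau>"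
  shows "\<sigma> = \<tau>"
  using assms face_of_eq[of \<sigma> P \<tau>] unfolding faces_def by blast

lemma flags_subset: "C \<in> flags P \<Longrightarrow> D \<subseteq> C \<Longrightarrow> D \<in> flags P"
  unfolding flags_def chains_def chain_subset_def by blast

lemma flags_faces: "C \<in> flags P \<Longrightarrow> \<sigma> \<in> C \<Longrightarrow> \<sigma> \<in> faces P"
  unfolding flags_def chains_def by blast

lemma flags_single: "\<sigma> \<in> faces P \<Longrightarrow> {\<sigma>} \<in> flags P"
  unfolding flags_def chains_def chain_subset_def by blast

lemma flags_finite: "polytope P \<Longrightarrow> finite (flags P)"
  by (rule finite_subset[of _ "Pow (faces P)"]) (auto simp: faces_finite flags_faces)

lemma flag_finite: "polytope P \<Longrightarrow> C \<in> flags P \<Longrightarrow> finite C"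
  by (rule finite_subset[of _ "faces P"]) (auto simp: faces_finite flags_faces)

lemma flags_insert:
  assumes "C \<in> flags P" "\<sigma> \<in> faces P" "\<And>\<tau>. \<tau> \<in> C \<Longrightarrow> \<tau> \<subseteq> \<sigma>"
  shows "insert \<sigma> C \<in> flags P"
  using assms unfolding flags_def chains_def chain_subset_def by blast

lemma flag_top:
  assumes "finite C" "C \<in> flags P" "C \<noteq> {}"
  obtains \<sigma> where "\<sigma> \<in> C" "\<forall>\<tau> \<in> C. \<tau> \<subseteq> \<sigma>"
proof -
  from finite_has_maximal[OF assms(1,3)]
  obtain \<sigma> where s: "\<sigma> \<in> C" "\<forall>\<tau> \<in> C. \<sigma> \<subseteq> \<tau> \<longrightarrow> \<sigma> = \<tau>" by auto
  have "\<forall>\<tau> \<in> C. \<tau> \<subseteq> \<sigma> \<or> \<sigma> \<subseteq> \<tau>"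
    using assms(2) s(1) by (auto simp: flags_def chains_def chain_subset_def)
  then have "\<forall>\<tau> \<in> C. \<tau> \<subseteq> \<sigma>" using s(2) by auto
  with s(1) show thesis by (rule that)
qed

section \<open>Cones over the boundary of a convex set\<close>

text \<open>In the following two facts \<open>y\<close> is arbitrary if \<open>a = 1\<close>, so that the case of an empty
  \<open>S\<close> needs no separate treatment.\<close>

lemma convex_hull_insertE:
  assumes "x \<in> convex hull (insert p S)"
  obtains a y where "0 \<le> a" "a \<le> 1" "x = a *\<^sub>R p + (1 - a) *\<^sub>R y" "a = 1 \<or> y \<in> convex hull S"
proof (cases "S = {}")
  case True
  then show thesis using assms that[of 1 p] by auto
next
  case False
  then obtain u y where "x = (1 - u) *\<^sub>R p + u *\<^sub>R y" "0 \<le> u" "u \<le> 1" "y \<in> convex hull S"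
    using assms by (auto simp: convex_hull_insert_alt)
  then show thesis using that[of "1 - u" y] by auto
qed

lemma convex_hull_insertI:
  assumes "0 \<le> a" "a \<le> 1" "a = 1 \<or> y \<in> convex hull S"
  shows "a *\<^sub>R p + (1 - a) *\<^sub>R y \<in> convex hull (insert p S)"
proof (cases "a = 1")
  case True
  then show ?thesis by (simp add: hull_inc)
next
  case False
  then have "y \<in> convex hull (insert p S)"
    using assms hull_mono[of S "insert p S" convex] by blast
  then show ?thesis
    using assms convexD[OF convex_convex_hull, of p "insert p S" y a "1 - a"]
    by (simp add: hull_inc)
qed

lemma rel_interior_towards:
  fixes K :: "'a::euclidean_space set"
  assumes "convex K" "p \<in> rel_interior K" "z \<in> K" "0 < a" "a \<le> 1"
  shows "a *\<^sub>R p + (1 - a) *\<^sub>R z \<in> rel_interior K"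
  using rel_interior_convex_shrink[OF assms] by (simp add: algebra_simps)

text \<open>The height of a point in the cone with apex \<open>p\<close> over the relative boundary of \<open>K\<close> is
  unique. If \<open>a < b\<close>, the equation would exhibit the base point \<open>y\<close> as a convex combination in
  which \<open>p\<close> has positive weight, so \<open>y\<close> would be in the relative interior. The statement is
  one-sided so that it can be applied twice with the roles of the two representations exchanged.\<close>

lemma cone_parameter_le:
  fixes K :: "'a::euclidean_space set"
  assumes K: "convex K" "p \<in> rel_interior K"
    and y: "y \<notin> rel_interior K" and z: "b = 1 \<or> z \<in> K"
    and ab: "0 \<le> a" "b \<le> 1"
    and eq: "a *\<^sub>R p + (1 - a) *\<^sub>R y = b *\<^sub>R p + (1 - b) *\<^sub>R z"
  shows "b \<le> a"
proof (rule ccontr)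
  assume "\<not> b \<le> a"
  then have lt: "a < b" by simp
  \<comment> \<open>the weight of \<open>p\<close> when the equation is solved for \<open>y\<close>\<close>
  define c where "c = (b - a) / (1 - a)"
  have a1: "1 - a > 0" using lt ab by simp
  have c: "0 < c" "c \<le> 1" "(1 - a) * c = b - a" "(1 - a) * (1 - c) = 1 - b"
    using lt ab a1 by (auto simp: c_def field_simps)
  have "(1 - a) *\<^sub>R y = (b - a) *\<^sub>R p + (1 - b) *\<^sub>R z"
    using eq by (simp add: algebra_simps)
  also have "\<dots> = (1 - a) *\<^sub>R (c *\<^sub>R p + (1 - c) *\<^sub>R z)"
    unfolding c(3,4)[symmetric] by (simp add: scaleR_add_right)
  finally have y_eq: "y = c *\<^sub>R p + (1 - c) *\<^sub>R z"
    using a1 by simp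
  show False
  proof (cases "b = 1")
    case True
    then have "c = 1" using a1 by (simp add: c_def)
    then show False using y y_eq K by simp
  next
    case False
    then show False using rel_interior_towards[OF K _ c(1,2)] z y y_eq by blast
  qed
qed

section \<open>The flag triangulation of a choice of points\<close>

locale face_points =
  fixes P :: "(real ^ 'n::finite) set" and v :: "(real ^ 'n) set \<Rightarrow> real ^ 'n"
  assumes polytope: "polytope P"
    and v_rel_interior: "\<sigma> \<in> faces P \<Longrightarrow> v \<sigma> \<in> rel_interior \<sigma>"
begin

lemma face_convex: "\<sigma> \<in> faces P \<Longrightarrow> convex \<sigma>"
  by (auto simp: faces_def face_of_imp_convex)

lemma face_polytope: "\<sigma> \<in> faces P \<Longrightarrow> polytope \<sigma>"
  using polytope face_of_polytope_polytope by (auto simp: faces_def)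

lemma face_subset: "\<sigma> \<in> faces P \<Longrightarrow> \<sigma> \<subseteq> P"
  by (auto simp: faces_def dest: face_of_imp_subset)

lemma v_in_face: "\<sigma> \<in> faces P \<Longrightarrow> v \<sigma> \<in> \<sigma>"
  using v_rel_interior rel_interior_subset by blast

lemma flag_hull_subset:
  assumes "C \<in> flags P" "\<sigma> \<in> faces P" "\<And>\<tau>. \<tau> \<in> C \<Longrightarrow> \<tau> \<subseteq> \<sigma>"
  shows "convex hull (v ` C) \<subseteq> \<sigma>"
proof (rule hull_minimal)
  show "v ` C \<subseteq> \<sigma>" using v_in_face[OF flags_faces[OF assms(1)]] assms(3) by auto
qed (rule face_convex[OF assms(2)])

text \<open>The largest member of the flag is the face wanted; it contains all the other members,
  hence all their points.\<close>

lemma lower_flag_in_proper_face: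
  assumes "C \<in> flags P" "\<sigma> \<in> faces P" "\<And>\<tau>. \<tau> \<in> C \<Longrightarrow> \<tau> \<subset> \<sigma>" "C \<noteq> {}"
  obtains \<rho> where "\<rho> \<in> faces P" "\<rho> face_of \<sigma>" "\<rho> \<noteq> \<sigma>" "v ` C \<subseteq> \<rho>"
proof -
  obtain \<rho> where r: "\<rho> \<in> C" "\<forall>\<tau> \<in> C. \<tau> \<subseteq> \<rho>"
    by (rule flag_top[OF flag_finite[OF polytope assms(1)] assms(1,4)])
  have "\<rho> \<in> faces P" using flags_faces assms(1) r by blast
  moreover have "\<rho> face_of \<sigma>" "\<rho> \<noteq> \<sigma>"
    using faces_subset_face_of[of \<sigma> P \<rho>] assms(2,3) r(1) \<open>\<rho> \<in> faces P\<close> by auto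
  moreover have "v ` C \<subseteq> \<rho>" using v_in_face flags_faces[OF assms(1)] r by blast
  ultimately show thesis using that by blast
qed

lemma lower_flag_hull_disjoint:
  assumes "C \<in> flags P" "\<sigma> \<in> faces P" "\<And>\<tau>. \<tau> \<in> C \<Longrightarrow> \<tau> \<subset> \<sigma>"
  shows "convex hull (v ` C) \<inter> rel_interior \<sigma> = {}"
proof (cases "C = {}")
  case False
  obtain \<rho> where r: "\<rho> \<in> faces P" "\<rho> face_of \<sigma>" "\<rho> \<noteq> \<sigma>" "v ` C \<subseteq> \<rho>"
    by (rule lower_flag_in_proper_face[OF assms False])
  have "convex hull (v ` C) \<subseteq> \<rho>" using face_convex[OF r(1)] r(4) by (simp add: hull_minimal)
  then show ?thesis using face_of_disjoint_rel_interior[OF r(2,3)] by blast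
qed simp

text \<open>Induction on the flag, removing its largest member \<open>\<sigma>\<close>. The remaining points lie in a
  proper face \<open>\<rho>\<close> of \<open>\<sigma>\<close>. A face is cut out of \<open>\<sigma>\<close> by its affine hull, so \<open>v \<sigma>\<close>, not being
  in \<open>\<rho>\<close>, is not in the affine hull of these points either.\<close>

lemma flag_affine_independent:
  assumes "C \<in> flags P"
  shows "\<not> affine_dependent (v ` C)"
  using flag_finite[OF polytope assms] assms
proof (induction C rule: finite_psubset_induct)
  case (psubset C)
  show ?case
  proof (cases "C = {}")
    case False
    obtain \<sigma> where s: "\<sigma> \<in> C" "\<forall>\<tau> \<in> C. \<tau> \<subseteq> \<sigma>"
      by (rule flag_top[OF psubset.hyps psubset.prems False])
    let ?D = "C - {\<sigma>}"
    have D: "?D \<in> flags P" by (rule flags_subset[OF psubset.prems]) blast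
    have sf: "\<sigma> \<in> faces P" by (rule flags_faces[OF psubset.prems s(1)])
    have low: "\<tau> \<subset> \<sigma>" if "\<tau> \<in> ?D" for \<tau>
      using s(2) that by auto
    have "v \<sigma> \<notin> affine hull (v ` ?D)"
    proof (cases "?D = {}")
      case False
      obtain \<rho> where r: "\<rho> \<in> faces P" "\<rho> face_of \<sigma>" "\<rho> \<noteq> \<sigma>" "v ` ?D \<subseteq> \<rho>"
        by (rule lower_flag_in_proper_face[OF D sf low False])
      have "v \<sigma> \<notin> \<rho>"
        using face_of_disjoint_rel_interior[OF r(2,3)] v_rel_interior[OF sf] by blast
      then have "v \<sigma> \<notin> affine hull \<rho>"
        using face_of_imp_eq_affine_Int[OF face_convex[OF sf] r(2)] v_in_face[OF sf] by blast
      then show ?thesis using hull_mono[OF r(4), of affine] by blast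
    next
      case True
      then show ?thesis by (metis affine_hull_empty empty_iff image_is_empty)
    qed
    moreover have "\<not> affine_dependent (v ` ?D)" using psubset.IH[of ?D] D s(1) by blast
    ultimately have "\<not> affine_dependent (insert (v \<sigma>) (v ` ?D))"
      using affine_independent_insert by blast
    moreover have "insert (v \<sigma>) (v ` ?D) = v ` C" using s(1) by blast
    ultimately show ?thesis by simp
  qed simp
qed

text \<open>The hull of a flag is the cone with apex at the point of its largest member over the hull
  of the remaining flag.\<close>

lemma flag_hull_split:
  assumes "C \<in> flags P" "x \<in> convex hull (v ` C)"
  obtains \<sigma> a y where "\<sigma> \<in> C" "\<forall>\<tau> \<in> C. \<tau> \<subseteq> \<sigma>" "0 \<le> a" "a \<le> 1"
    "x = a *\<^sub>R v \<sigma> + (1 - a) *\<^sub>R y" "a = 1 \<or> y \<in> convex hull (v ` (C - {\<sigma>}))"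
proof -
  have "C \<noteq> {}" using assms(2) by auto
  obtain \<sigma> where s: "\<sigma> \<in> C" "\<forall>\<tau> \<in> C. \<tau> \<subseteq> \<sigma>"
    by (rule flag_top[OF flag_finite[OF polytope assms(1)] assms(1) \<open>C \<noteq> {}\<close>])
  have "v ` C = insert (v \<sigma>) (v ` (C - {\<sigma>}))" using s(1) by blast
  then have "x \<in> convex hull (insert (v \<sigma>) (v ` (C - {\<sigma>})))" using assms(2) by simp
  then show thesis by (rule convex_hull_insertE) (rule that[OF s])
qed

text \<open>Write \<open>x\<close> in both hulls as a convex combination of the apex and a point of the opposite
  side. If an apex has weight 0, its member can be dropped from the flag. Otherwise \<open>x\<close> is in the
  relative interior of the largest members of both flags, which therefore coincide. The opposite
  sides lie in the relative boundary of this face, so the weights agree by \<open>cone_parameter_le\<close>,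
  hence so do the points on the opposite sides unless both weights are 1, and induction applies
  to those.\<close>

lemma flag_hull_Int:
  assumes "C \<in> flags P" "D \<in> flags P" "x \<in> convex hull (v ` C)" "x \<in> convex hull (v ` D)"
  shows "x \<in> convex hull (v ` (C \<inter> D))"
  using assms
proof (induction "card C + card D" arbitrary: C D x rule: less_induct)
  case less
  note C = less.prems(1) and D = less.prems(2)
  have fin: "finite C" "finite D" using C D flag_finite polytope by auto
  obtain \<sigma> a y where s: "\<sigma> \<in> C" "\<forall>\<tau> \<in> C. \<tau> \<subseteq> \<sigma>" and a: "0 \<le> a" "a \<le> 1"
    and x: "x = a *\<^sub>R v \<sigma> + (1 - a) *\<^sub>R y" and y: "a = 1 \<or> y \<in> convex hull (v ` (C - {\<sigma>}))"
    by (rule flag_hull_split[OF C less.prems(3)])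
  obtain \<tau> b z where t: "\<tau> \<in> D" "\<forall>\<rho> \<in> D. \<rho> \<subseteq> \<tau>" and b: "0 \<le> b" "b \<le> 1"
    and x': "x = b *\<^sub>R v \<tau> + (1 - b) *\<^sub>R z" and z: "b = 1 \<or> z \<in> convex hull (v ` (D - {\<tau>}))"
    by (rule flag_hull_split[OF D less.prems(4)])
  have C': "C - {\<sigma>} \<in> flags P" and D': "D - {\<tau>} \<in> flags P"
    by (auto intro: flags_subset[OF C] flags_subset[OF D])
  have sf: "\<sigma> \<in> faces P" and tf: "\<tau> \<in> faces P" using flags_faces[OF C s(1)] flags_faces[OF D t(1)] .
  have cards: "card (C - {\<sigma>}) < card C" "card (D - {\<tau>}) < card D"
    using fin s(1) t(1) by (meson card_Diff1_less)+
  consider "a = 0" | "b = 0" | "0 < a" "0 < b" using a b by linarith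
  then show ?case
  proof cases
    case 1
    then have "x \<in> convex hull (v ` ((C - {\<sigma>}) \<inter> D))"
      using less.hyps[of "C - {\<sigma>}" D x] C' D x y less.prems(4) cards by simp
    then show ?thesis using hull_mono[of "v ` ((C - {\<sigma>}) \<inter> D)" "v ` (C \<inter> D)" convex] by blast
  next
    case 2
    then have "x \<in> convex hull (v ` (C \<inter> (D - {\<tau>})))"
      using less.hyps[of C "D - {\<tau>}" x] C D' x' z less.prems(3) cards by simp
    then show ?thesis using hull_mono[of "v ` (C \<inter> (D - {\<tau>}))" "v ` (C \<inter> D)" convex] by blast
  next
    case 3
    have ys: "a = 1 \<or> y \<in> \<sigma>" using y flag_hull_subset[OF C' sf] s(2) by blast
    have zt: "b = 1 \<or> z \<in> \<tau>" using z flag_hull_subset[OF D' tf] t(2) by blast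
    have xs: "x \<in> rel_interior \<sigma>"
      using rel_interior_towards[OF face_convex[OF sf] v_rel_interior[OF sf] _ 3(1) a(2)] ys x
        v_rel_interior[OF sf] by (cases "a = 1") auto
    have xt: "x \<in> rel_interior \<tau>"
      using rel_interior_towards[OF face_convex[OF tf] v_rel_interior[OF tf] _ 3(2) b(2)] zt x'
        v_rel_interior[OF tf] by (cases "b = 1") auto
    have st: "\<tau> = \<sigma>" using faces_eqI[OF tf sf xt xs] .
    have y': "a = 1 \<or> y \<notin> rel_interior \<sigma>"
      using y lower_flag_hull_disjoint[OF C' sf] s(2) by blast
    have z': "b = 1 \<or> z \<notin> rel_interior \<sigma>"
      using z lower_flag_hull_disjoint[OF D' tf] t(2) st by blast
    have eq: "a *\<^sub>R v \<sigma> + (1 - a) *\<^sub>R y = b *\<^sub>R v \<sigma> + (1 - b) *\<^sub>R z"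
      using x x' st by simp
    have "b \<le> a"
      using cone_parameter_le[OF face_convex[OF sf] v_rel_interior[OF sf], of y b z a]
        y' zt st a b eq by blast
    moreover have "a \<le> b"
      using cone_parameter_le[OF face_convex[OF sf] v_rel_interior[OF sf], of z a y b]
        z' ys a b eq[symmetric] by blast
    ultimately have ab: "a = b" by simp
    have "a = 1 \<or> y \<in> convex hull (v ` ((C - {\<sigma>}) \<inter> (D - {\<sigma>})))"
    proof (cases "a = 1")
      case False
      then have "y = z" using eq ab by simp
      then show ?thesis
        using less.hyps[of "C - {\<sigma>}" "D - {\<sigma>}" y] C' D' y z False ab cards st by simp
    qed simp
    then have "x \<in> convex hull (insert (v \<sigma>) (v ` ((C - {\<sigma>}) \<inter> (D - {\<sigma>}))))"
      unfolding x using a by (rule_tac convex_hull_insertI) auto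
    moreover have "insert (v \<sigma>) (v ` ((C - {\<sigma>}) \<inter> (D - {\<sigma>}))) = v ` (C \<inter> D)"
      using s(1) t(1) st by blast
    ultimately show ?thesis by simp
  qed
qed

text \<open>Induction on the dimension of \<open>\<sigma>\<close>: the ray from \<open>v \<sigma>\<close> through \<open>x\<close> leaves \<open>\<sigma>\<close> in a point of
  a proper face \<open>\<rho>\<close>. This point lies in the hull of a flag of faces of \<open>\<rho>\<close>, and \<open>\<sigma>\<close> can be added to
  that flag.\<close>

lemma flag_hulls_cover:
  assumes "\<sigma> \<in> faces P" "x \<in> \<sigma>"
  shows "\<exists>C \<in> flags P. (\<forall>\<tau> \<in> C. \<tau> \<subseteq> \<sigma>) \<and> x \<in> convex hull (v ` C)"
  using assms
proof (induction "nat (aff_dim \<sigma>)" arbitrary: \<sigma> x rule: less_induct)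
  case less
  note sf = less.prems(1)
  show ?case
  proof (cases "x = v \<sigma>")
    case True
    then show ?thesis using flags_single[OF sf] by (intro bexI[of _ "{\<sigma>}"]) auto
  next
    case False
    let ?l = "x - v \<sigma>"
    have pol: "polytope \<sigma>" using face_polytope[OF sf] .
    have "v \<sigma> + ?l \<in> affine hull \<sigma>" using less.prems(2) by (simp add: hull_inc)
    then obtain d where d: "0 < d" "v \<sigma> + d *\<^sub>R ?l \<in> rel_frontier \<sigma>"
      using ray_to_rel_frontier[OF polytope_imp_bounded[OF pol] v_rel_interior[OF sf]] False
      by (metis right_minus_eq)
    let ?y = "v \<sigma> + d *\<^sub>R ?l"
    \<comment> \<open>otherwise the exit point would be strictly between \<open>v \<sigma>\<close> and \<open>x\<close>, hence interior\<close>
    have "1 \<le> d"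
    proof (rule ccontr)
      assume "\<not> 1 \<le> d"
      then have "(1 - d) *\<^sub>R v \<sigma> + (1 - (1 - d)) *\<^sub>R x \<in> rel_interior \<sigma>"
        using d(1)
        by (intro rel_interior_towards face_convex[OF sf] v_rel_interior[OF sf] less.prems(2)) auto
      then show False using d(2) by (simp add: rel_frontier_def algebra_simps)
    qed
    obtain \<rho> where r: "\<rho> face_of \<sigma>" "\<rho> \<noteq> \<sigma>" "?y \<in> \<rho>"
      using d(2) rel_frontier_of_polyhedron_alt[OF polytope_imp_polyhedron[OF pol]] by blast
    have rf: "\<rho> \<in> faces P" using faces_trans[OF sf r(1)] r(3) by blast
    have "aff_dim \<rho> < aff_dim \<sigma>" using face_of_aff_dim_lt face_convex[OF sf] r by blast
    moreover have "0 \<le> aff_dim \<rho>" using r(3) aff_dim_negative_iff[of \<rho>] by (metis empty_iff not_le)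
    ultimately have "nat (aff_dim \<rho>) < nat (aff_dim \<sigma>)" by simp
    then obtain C where C: "C \<in> flags P" "\<forall>\<tau> \<in> C. \<tau> \<subseteq> \<rho>" "?y \<in> convex hull (v ` C)"
      using less.hyps[OF _ rf r(3)] by blast
    have sub: "\<tau> \<subseteq> \<sigma>" if "\<tau> \<in> C" for \<tau> using C(2) that r(1) face_of_imp_subset by blast
    have "x = (1 - 1/d) *\<^sub>R v \<sigma> + (1 - (1 - 1/d)) *\<^sub>R ?y"
      using d(1) by (simp add: algebra_simps)
    moreover have "\<dots> \<in> convex hull (insert (v \<sigma>) (v ` C))"
      using \<open>1 \<le> d\<close> C(3) by (intro convex_hull_insertI) auto
    ultimately have "x \<in> convex hull (v ` insert \<sigma> C)" by simp
    then show ?thesis using flags_insert[OF C(1) sf sub] sub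
      by (intro bexI[of _ "insert \<sigma> C"]) auto
  qed
qed

lemma flag_hulls_simplicial_complex:
  "simplicial_complex ((\<lambda>C. convex hull (v ` C)) ` flags P)"
  unfolding simplicial_complex_def
proof (intro conjI ballI allI impI)
  show "finite ((\<lambda>C. convex hull (v ` C)) ` flags P)"
    using flags_finite[OF polytope] by blast
next
  fix S assume "S \<in> (\<lambda>C. convex hull (v ` C)) ` flags P"
  then obtain C where C: "C \<in> flags P" "S = convex hull (v ` C)" by blast
  then have "(int (card (v ` C)) - 1) simplex S"
    using simplex_convex_hull[of "v ` C" "int (card (v ` C)) - 1"] flag_affine_independent by simp
  then show "\<exists>n. n simplex S" ..
next
  fix F S assume "S \<in> (\<lambda>C. convex hull (v ` C)) ` flags P \<and> F face_of S"
  then obtain C where C: "C \<in> flags P" "F face_of convex hull (v ` C)" by blast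
  then obtain c where c: "c \<subseteq> v ` C" "F = convex hull c"
    using face_of_convex_hull_affine_independent[OF flag_affine_independent] by blast
  then obtain D where D: "D \<subseteq> C" "c = v ` D" by (auto simp: subset_image_iff)
  show "F \<in> (\<lambda>C. convex hull (v ` C)) ` flags P"
    using c(2) D(2) flags_subset[OF C(1) D(1)] by auto
next
  fix S S' assume "S \<in> (\<lambda>C. convex hull (v ` C)) ` flags P \<and> S' \<in> (\<lambda>C. convex hull (v ` C)) ` flags P"
  then obtain C D where CD: "C \<in> flags P" "D \<in> flags P"
    "S = convex hull (v ` C)" "S' = convex hull (v ` D)" by blast
  have "S \<inter> S' = convex hull (v ` (C \<inter> D))"
  proof
    show "S \<inter> S' \<subseteq> convex hull (v ` (C \<inter> D))" using flag_hull_Int CD by blast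
    show "convex hull (v ` (C \<inter> D)) \<subseteq> S \<inter> S'"
      unfolding CD by (intro Int_greatest hull_mono) auto
  qed
  then show "S \<inter> S' face_of S"
    unfolding CD(3) face_of_convex_hull_affine_independent[OF flag_affine_independent[OF CD(1)]]
    by (intro exI[of _ "v ` (C \<inter> D)"]) auto
qed

lemma flag_hulls_triangulation:
  "triangulation_of P ((\<lambda>C. convex hull (v ` C)) ` flags P)"
proof -
  have "\<Union> ((\<lambda>C. convex hull (v ` C)) ` flags P) = P"
  proof
    have "convex hull (v ` C) \<subseteq> P" if "C \<in> flags P" for C
    proof (rule hull_minimal)
      show "v ` C \<subseteq> P"
        using v_in_face flags_faces[OF that] face_subset by blast
      show "convex P" using polytope polytope_imp_convex by blast
    qed
    then show "\<Union> ((\<lambda>C. convex hull (v ` C)) ` flags P) \<subseteq> P" by blast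
    have "P \<in> faces P" if "x \<in> P" for x
      using that polytope by (auto simp: faces_def polytope_imp_convex face_of_refl)
    then show "P \<subseteq> \<Union> ((\<lambda>C. convex hull (v ` C)) ` flags P)" using flag_hulls_cover by blast
  qed
  then show ?thesis unfolding triangulation_of_def using flag_hulls_simplicial_complex by blast
qed

lemma flag_hulls_vertices:
  "complex_vertices ((\<lambda>C. convex hull (v ` C)) ` flags P) = v ` faces P"
proof -
  have "complex_vertices ((\<lambda>C. convex hull (v ` C)) ` flags P)
      = (\<Union>C \<in> flags P. {x. x extreme_point_of (convex hull (v ` C))})"
    unfolding complex_vertices_def by auto
  also have "\<dots> = (\<Union>C \<in> flags P. v ` C)"
    using extreme_point_of_convex_hull_affine_independent[OF flag_affine_independent]
    by (intro SUP_cong) auto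
  also have "\<dots> = v ` faces P"
  proof
    show "(\<Union>C \<in> flags P. v ` C) \<subseteq> v ` faces P"
      by (auto intro: flags_faces)
    show "v ` faces P \<subseteq> (\<Union>C \<in> flags P. v ` C)"
      by (auto intro!: bexI[OF _ flags_single])
  qed
  finally show ?thesis .
qed

lemma flag_hulls_vertex_iff:
  assumes "\<sigma> \<in> faces P"
  shows "x \<in> complex_vertices ((\<lambda>C. convex hull (v ` C)) ` flags P) \<and> x \<in> rel_interior \<sigma>
    \<longleftrightarrow> x = v \<sigma>"
  unfolding flag_hulls_vertices
proof
  assume "x \<in> v ` faces P \<and> x \<in> rel_interior \<sigma>"
  then obtain \<tau> where "\<tau> \<in> faces P" "x = v \<tau>" "x \<in> rel_interior \<sigma>" by auto
  then show "x = v \<sigma>" using faces_eqI[OF assms, of \<tau> x] v_rel_interior[of \<tau>] by simp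
qed (use assms v_rel_interior in auto)

lemma flag_hulls_face_vertex:
  assumes "\<sigma> \<in> faces P"
  shows "face_vertex ((\<lambda>C. convex hull (v ` C)) ` flags P) \<sigma> = v \<sigma>"
  unfolding face_vertex_def flag_hulls_vertex_iff[OF assms] by simp

end

text \<open>The data by which both sides of the bijection are parametrised. The functions are
  extensional, so that equal choices are equal functions.\<close>

definition rational_face_points ::
  "(real ^ 'n::finite) set \<Rightarrow> ((real ^ 'n) set \<Rightarrow> real ^ 'n) set" where
  "rational_face_points P = (\<Pi>\<^sub>E \<sigma> \<in> faces P. {x \<in> rel_interior \<sigma>. rational_point x})"

lemma flag_triangulations_bij:
  assumes "polytope P"
  shows "bij_betw (\<lambda>\<Delta>. restrict (face_vertex (\<Delta> ` flags P)) (faces P))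
           (flag_triangulations P) (rational_face_points P)"
proof (rule bij_betw_byWitness[where f' = "\<lambda>v. restrict (\<lambda>C. convex hull (v ` C)) (flags P)"])
  let ?pts = "\<lambda>\<Delta>. restrict (face_vertex (\<Delta> ` flags P)) (faces P)"
  let ?tri = "\<lambda>v. restrict (\<lambda>C. convex hull (v ` C)) (flags P)"
  have img: "?pts \<Delta> ` C = face_vertex (\<Delta> ` flags P) ` C" if "C \<in> flags P" for \<Delta> C
    using flags_faces[OF that] by (intro image_cong) auto
  show "\<forall>\<Delta> \<in> flag_triangulations P. ?tri (?pts \<Delta>) = \<Delta>"
  proof
    fix \<Delta> assume D: "\<Delta> \<in> flag_triangulations P"
    show "?tri (?pts \<Delta>) = \<Delta>"
    proof (rule extensionalityI[of _ "flags P"])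
      show "\<Delta> \<in> extensional (flags P)" using D unfolding flag_triangulations_def by blast
      show "?tri (?pts \<Delta>) C = \<Delta> C" if "C \<in> flags P" for C
      proof -
        have "\<Delta> C = convex hull (face_vertex (\<Delta> ` flags P) ` C)"
          using D that unfolding flag_triangulations_def Let_def by blast
        then show ?thesis using that img[OF that, of \<Delta>] by simp
      qed
    qed simp
  qed
  have fp: "face_points P v" if "v \<in> rational_face_points P" for v
    using that assms unfolding face_points_def rational_face_points_def by auto
  have tri_img: "?tri v ` flags P = (\<lambda>C. convex hull (v ` C)) ` flags P" for v
    by (intro image_cong) auto
  have fv: "face_vertex (?tri v ` flags P) \<sigma> = v \<sigma>"
    if "v \<in> rational_face_points P" "\<sigma> \<in> faces P" for v \<sigma>
    unfolding tri_img using face_points.flag_hulls_face_vertex[OF fp] that by blast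
  show "\<forall>v \<in> rational_face_points P. ?pts (?tri v) = v"
  proof
    fix v assume v: "v \<in> rational_face_points P"
    show "?pts (?tri v) = v"
    proof (rule extensionalityI[of _ "faces P"])
      show "v \<in> extensional (faces P)" using v by (auto simp: rational_face_points_def PiE_def)
    qed (use fv v in auto)
  qed
  show "?pts ` flag_triangulations P \<subseteq> rational_face_points P"
  proof clarify
    fix \<Delta> assume D: "\<Delta> \<in> flag_triangulations P"
    have "face_vertex (\<Delta> ` flags P) \<sigma> \<in> {x \<in> rel_interior \<sigma>. rational_point x}"
      if "\<sigma> \<in> faces P" for \<sigma>
    proof -
      have "\<exists>!x. x \<in> complex_vertices (\<Delta> ` flags P) \<and> x \<in> rel_interior \<sigma>"
        using D that unfolding flag_triangulations_def Let_def by blast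
      from theI'[OF this]
      have "face_vertex (\<Delta> ` flags P) \<sigma> \<in> complex_vertices (\<Delta> ` flags P)"
        "face_vertex (\<Delta> ` flags P) \<sigma> \<in> rel_interior \<sigma>"
        unfolding face_vertex_def by blast+
      moreover have "\<forall>x \<in> complex_vertices (\<Delta> ` flags P). rational_point x"
        using D unfolding flag_triangulations_def Let_def by blast
      ultimately show ?thesis by blast
    qed
    then show "?pts \<Delta> \<in> rational_face_points P" by (simp add: rational_face_points_def)
  qed
  show "?tri ` rational_face_points P \<subseteq> flag_triangulations P"
  proof clarify
    fix v assume v: "v \<in> rational_face_points P"
    interpret face_points P v using fp[OF v] .
    have "\<forall>x \<in> v ` faces P. rational_point x"
      using v by (auto simp: rational_face_points_def)
    moreover have "face_vertex (?tri v ` flags P) ` C = v ` C" if "C \<in> flags P" for C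
      using fv[OF v] flags_faces[OF that] by (intro image_cong) auto
    ultimately show "?tri v \<in> flag_triangulations P"
      unfolding flag_triangulations_def Let_def tri_img
      by (simp add: flag_hulls_triangulation flag_hulls_vertices flag_hulls_vertex_iff
          flag_hulls_vertex_iff[unfolded flag_hulls_vertices])
  qed
qed

section \<open>Monomials and polynomials on the affine cone\<close>

lemma peval_eq_sum:
  assumes "finite A" "Poly_Mapping.keys p \<subseteq> A"
  shows "peval p x = (\<Sum>m\<in>A. Poly_Mapping.lookup p m *
     (\<Prod>\<xi>\<in>Poly_Mapping.keys m. x \<xi> ^ Poly_Mapping.lookup m \<xi>))"
  unfolding peval_def using assms
  by (intro sum.mono_neutral_left) (auto simp: in_keys_iff)

definition monomial_value :: "(int ^ 'n::finite \<Rightarrow>\<^sub>0 nat) \<Rightarrow> ('k::field, 'n) vect \<Rightarrow> 'k" where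
  "monomial_value m x = (\<Prod>\<xi>\<in>Poly_Mapping.keys m. x \<xi> ^ Poly_Mapping.lookup m \<xi>)"

definition monomial_degree :: "(int ^ 'n \<Rightarrow>\<^sub>0 nat) \<Rightarrow> nat" where
  "monomial_degree m = (\<Sum>\<xi>\<in>Poly_Mapping.keys m. Poly_Mapping.lookup m \<xi>)"

lemma monomial_value_zero: "monomial_value 0 x = 1"
  by (simp add: monomial_value_def)

lemma monomial_value_superset:
  assumes "finite A" "Poly_Mapping.keys m \<subseteq> A"
  shows "monomial_value m x = (\<Prod>\<xi>\<in>A. x \<xi> ^ Poly_Mapping.lookup m \<xi>)"
  unfolding monomial_value_def using assms
  by (intro prod.mono_neutral_left) (auto simp: in_keys_iff)

lemma monomial_value_plus: "monomial_value (m + m') x = monomial_value m x * monomial_value m' x"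
proof -
  let ?A = "Poly_Mapping.keys m \<union> Poly_Mapping.keys m'"
  have "finite ?A" "Poly_Mapping.keys (m + m') \<subseteq> ?A"
    using keys_add[of m m'] by auto
  then show ?thesis
    by (simp add: monomial_value_superset[of ?A] lookup_add power_add prod.distrib)
qed

lemma monomial_value_single: "monomial_value (Poly_Mapping.single \<xi> 1) x = x \<xi>"
  by (simp add: monomial_value_def)

lemma monomial_value_mult:
  "monomial_value m (\<lambda>\<xi>. x \<xi> * y \<xi>) = monomial_value m x * monomial_value m y"
  by (simp add: monomial_value_def power_mult_distrib prod.distrib)

lemma monomial_value_const: "monomial_value m (\<lambda>\<xi>. c) = c ^ monomial_degree m"
  by (simp add: monomial_value_def monomial_degree_def power_sum)

lemma monomial_degree_plus: "monomial_degree (m + m') = monomial_degree m + monomial_degree m'"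
  unfolding monomial_degree_def by (rule setsum_keys_plus_distrib) auto

lemma monomial_degree_single: "monomial_degree (Poly_Mapping.single \<xi> 1) = 1"
  by (simp add: monomial_degree_def)

lemma peval_monomial_value: "peval p x =
    (\<Sum>m\<in>Poly_Mapping.keys p. Poly_Mapping.lookup p m * monomial_value m x)"
  by (simp add: peval_def monomial_value_def)

lemma peval_single: "peval (Poly_Mapping.single m 1) x = monomial_value m x"
  by (simp add: peval_monomial_value)

lemma peval_scale:
  assumes "p \<in> homogeneous_polynomials P d"
  shows "peval p (\<lambda>\<xi>. c * x \<xi>) = c ^ d * peval p x"
proof -
  have "peval p (\<lambda>\<xi>. c * x \<xi>) =
      (\<Sum>m\<in>Poly_Mapping.keys p. Poly_Mapping.lookup p m * (c ^ monomial_degree m * monomial_value m x))"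
    by (simp add: peval_monomial_value monomial_value_mult monomial_value_const)
  also have "\<dots> = (\<Sum>m\<in>Poly_Mapping.keys p. c ^ d * (Poly_Mapping.lookup p m * monomial_value m x))"
    using assms by (intro sum.cong) (auto simp: homogeneous_polynomials_def monomial_degree_def)
  finally show ?thesis by (simp add: peval_monomial_value sum_distrib_left)
qed

text \<open>The pullback of a polynomial under the diagonal map \<open>x\<^sub>\<xi> \<mapsto> w\<^sub>\<xi> x\<^sub>\<xi>\<close>.\<close>

definition rescale_polynomial :: "('k::field, 'n::finite) vect \<Rightarrow> ('k, 'n) polyn \<Rightarrow> ('k, 'n) polyn" where
  "rescale_polynomial w = Poly_Mapping.mapp (\<lambda>m a. a * monomial_value m w)"

lemma rescale_polynomial_homogeneous:
  assumes "p \<in> homogeneous_polynomials P d"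
  shows "rescale_polynomial w p \<in> homogeneous_polynomials P d"
  using assms keys_mapp_subset[of "\<lambda>m a. a * monomial_value m w" p]
  unfolding rescale_polynomial_def homogeneous_polynomials_def polynomials_def by blast

lemma peval_rescale: "peval (rescale_polynomial w p) x = peval p (\<lambda>\<xi>. w \<xi> * x \<xi>)"
proof -
  have "peval (rescale_polynomial w p) x = (\<Sum>m\<in>Poly_Mapping.keys p.
      Poly_Mapping.lookup (rescale_polynomial w p) m * monomial_value m x)"
    unfolding monomial_value_def rescale_polynomial_def
    by (rule peval_eq_sum) (simp_all add: keys_mapp_subset)
  also have "\<dots> = peval p (\<lambda>\<xi>. w \<xi> * x \<xi>)"
    unfolding peval_monomial_value monomial_value_mult
    by (intro sum.cong) (auto simp: rescale_polynomial_def lookup_mapp)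
  finally show ?thesis .
qed

section \<open>The torus action on the affine cone\<close>

lemma affine_cone_scale:
  assumes "x \<in> affine_cone P" "c \<noteq> 0"
  shows "(\<lambda>\<xi>. c * x \<xi>) \<in> affine_cone P"
proof -
  have "proj_point (\<lambda>\<xi>. c * x \<xi>) = proj_point x"
  proof
    show "proj_point (\<lambda>\<xi>. c * x \<xi>) \<subseteq> proj_point x"
    proof
      fix y assume "y \<in> proj_point (\<lambda>\<xi>. c * x \<xi>)"
      then obtain a where "y = (\<lambda>\<xi>. a * (c * x \<xi>))" "a \<noteq> 0" by (auto simp: proj_point_def)
      then have "y = (\<lambda>\<xi>. (a * c) * x \<xi>) \<and> a * c \<noteq> 0" using assms(2) by (simp add: mult.assoc)
      then show "y \<in> proj_point x" unfolding proj_point_def by blast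
    qed
    show "proj_point x \<subseteq> proj_point (\<lambda>\<xi>. c * x \<xi>)"
    proof
      fix y assume "y \<in> proj_point x"
      then obtain a where "y = (\<lambda>\<xi>. a * x \<xi>)" "a \<noteq> 0" by (auto simp: proj_point_def)
      then have "y = (\<lambda>\<xi>. (a / c) * (c * x \<xi>)) \<and> a / c \<noteq> 0" using assms(2) by auto
      then show "y \<in> proj_point (\<lambda>\<xi>. c * x \<xi>)" unfolding proj_point_def by blast
    qed
  qed
  then show ?thesis using assms by (auto simp: affine_cone_def vspace_def fun_eq_iff)
qed

lemma orbit_subset_X_face: "orbit P \<sigma> \<subseteq> X_face P \<sigma>"
  unfolding X_face_def zariski_closure_def by blast

lemma character_mult:
  "character \<xi> (\<chi> i. s $ i * t $ i) = character \<xi> s * character \<xi> (t :: 'k::field ^ 'n::finite)"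
  by (simp add: character_def power_int_mult_distrib prod.distrib)

lemma character_nonzero: "t \<in> torus \<Longrightarrow> character \<xi> t \<noteq> 0"
  by (simp add: character_def torus_def)

lemma character_zero: "character 0 t = 1"
  by (simp add: character_def)

lemma character_plus:
  assumes "t \<in> torus"
  shows "character (\<xi> + \<psi>) t = character \<xi> t * character \<psi> t"
  using assms by (simp add: character_def torus_def power_int_add prod.distrib)

lemma character_inverse:
  "character \<xi> (\<chi> i. inverse (t $ i)) = character (- \<xi>) t"
  by (simp add: character_def power_int_inverse power_int_minus)

text \<open>Translation by \<open>s\<close> maps the orbit onto itself, and the preimage \<open>Z'\<close> of a closed set \<open>Z\<close> under
  it is closed, being defined by the rescaled equations. If \<open>Z\<close> contains the orbit, so does
  \<open>Z'\<close>, which then contains the closure of the orbit.\<close>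

lemma toric_variety_torus_invariant:
  fixes x :: "('k::field, 'n::finite) vect"
  assumes x: "x \<in> vspace P" "x \<noteq> (\<lambda>_. 0)" "proj_point x \<in> toric_variety P" and s: "s \<in> torus"
  shows "proj_point (\<lambda>\<xi>. character \<xi> s * x \<xi>) \<in> toric_variety P"
  unfolding toric_variety_def X_face_def zariski_closure_def
proof clarify
  fix Z :: "('k, 'n) vect set set" assume Z: "zariski_closed P Z" "orbit P P \<subseteq> Z"
  let ?w = "\<lambda>\<xi>. character \<xi> s"
  have translate: "proj_point (\<lambda>\<xi>. ?w \<xi> * y \<xi>) = (\<lambda>z \<xi>. ?w \<xi> * z \<xi>) ` proj_point y" for y
  proof -
    have "proj_point (\<lambda>\<xi>. ?w \<xi> * y \<xi>) = {(\<lambda>\<xi>. ?w \<xi> * (c * y \<xi>)) | c. c \<noteq> 0}"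
      unfolding proj_point_def by (simp add: mult.left_commute)
    also have "\<dots> = (\<lambda>z \<xi>. ?w \<xi> * z \<xi>) ` proj_point y"
      unfolding proj_point_def by (simp add: setcompr_eq_image image_image)
    finally show ?thesis .
  qed
  obtain S where S: "S \<subseteq> (\<Union>d. homogeneous_polynomials P d)"
    "Z = {l \<in> proj_space P. \<forall>p\<in>S. \<forall>x\<in>l. peval p x = 0}"
    using Z(1) unfolding zariski_closed_def by blast
  define Z' where "Z' = {l \<in> proj_space P. \<forall>p\<in>rescale_polynomial ?w ` S. \<forall>x\<in>l. peval p x = 0}"
  have "rescale_polynomial ?w ` S \<subseteq> (\<Union>d. homogeneous_polynomials P d)"
  proof (rule image_subsetI)
    fix p assume "p \<in> S"
    then obtain d where "p \<in> homogeneous_polynomials P d" using S(1) by blast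
    then show "rescale_polynomial ?w p \<in> (\<Union>d. homogeneous_polynomials P d)"
      using rescale_polynomial_homogeneous[of p P d ?w] by blast
  qed
  then have closed: "zariski_closed P Z'"
    unfolding zariski_closed_def Z'_def by (intro exI conjI) auto
  have Z'I: "proj_point y \<in> Z'" if "proj_point y \<in> proj_space P"
    "proj_point (\<lambda>\<xi>. ?w \<xi> * y \<xi>) \<in> Z" for y
    using that unfolding Z'_def S(2) translate by (auto simp: peval_rescale)
  have "orbit P P \<subseteq> Z'"
  proof
    fix l :: "('k, 'n) vect set" assume l: "l \<in> orbit P P"
    then obtain t where t: "t \<in> torus"
      and l_eq: "l = proj_point (\<lambda>\<xi>. if \<xi> \<in> Lam P \<and> of_lat \<xi> \<in> P then character \<xi> t else 0)"
      unfolding orbit_def by blast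
    let ?u = "\<chi> i. s $ i * t $ i"
    have "?u \<in> torus" using s t by (simp add: torus_def)
    then have "proj_point (\<lambda>\<xi>. if \<xi> \<in> Lam P \<and> of_lat \<xi> \<in> P then character \<xi> ?u else 0) \<in> Z"
      using Z(2) unfolding orbit_def by blast
    moreover have "(\<lambda>\<xi>. if \<xi> \<in> Lam P \<and> of_lat \<xi> \<in> P then character \<xi> ?u else 0)
        = (\<lambda>\<xi>. ?w \<xi> * (if \<xi> \<in> Lam P \<and> of_lat \<xi> \<in> P then character \<xi> t else 0))"
      by (auto simp: fun_eq_iff character_mult)
    ultimately have "proj_point (\<lambda>\<xi>. ?w \<xi> * (if \<xi> \<in> Lam P \<and> of_lat \<xi> \<in> P then character \<xi> t else 0)) \<in> Z"
      by simp
    moreover have "l \<in> proj_space P" using l Z(2) S(2) by blast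
    ultimately show "l \<in> Z'" using Z'I l_eq by simp
  qed
  then have "Z' \<in> {Z. zariski_closed P Z \<and> orbit P P \<subseteq> Z}" using closed by simp
  then have "proj_point x \<in> Z'"
    using x(3) unfolding toric_variety_def X_face_def zariski_closure_def by (rule InterD[rotated])
  then have "\<forall>p\<in>S. \<forall>y\<in>proj_point (\<lambda>\<xi>. ?w \<xi> * x \<xi>). peval p y = 0"
    unfolding Z'_def translate by (simp add: peval_rescale)
  moreover obtain \<xi> where "x \<xi> \<noteq> 0" using x(2) by auto
  then have "(\<lambda>\<xi>. ?w \<xi> * x \<xi>) \<noteq> (\<lambda>_. 0)"
    using character_nonzero[OF s] by (metis mult_eq_0_iff)
  then have "proj_point (\<lambda>\<xi>. ?w \<xi> * x \<xi>) \<in> proj_space P"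
    using x(1) unfolding proj_space_def by (intro imageI) (auto simp: vspace_def)
  ultimately show "proj_point (\<lambda>\<xi>. ?w \<xi> * x \<xi>) \<in> Z" unfolding S(2) by simp
qed

lemma affine_cone_act:
  assumes "s \<in> ext_torus" "x \<in> affine_cone P"
  shows "act_vect s x \<in> affine_cone P"
proof -
  obtain c t where s: "s = (c, t)" "c \<noteq> 0" "t \<in> torus"
    using assms(1) by (auto simp: ext_torus_def)
  have "(\<lambda>\<xi>. character \<xi> t * x \<xi>) \<in> affine_cone P"
  proof (cases "x = (\<lambda>_. 0)")
    case True
    then show ?thesis using assms(2) by simp
  next
    case False
    then show ?thesis
      using toric_variety_torus_invariant[of x P t] assms(2) s(3)
      unfolding affine_cone_def by (auto simp: vspace_def)
  qed
  from affine_cone_scale[OF this s(2)] show ?thesis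
    by (simp add: s(1) mult.assoc)
qed

lemma ext_inverse_in_ext_torus: "s \<in> ext_torus \<Longrightarrow> ext_inverse s \<in> ext_torus"
  by (auto simp: ext_torus_def torus_def)

text \<open>The identity element of the dense torus, as a vector of \<open>V\<close>; no monomial in the coordinates
  vanishes there.\<close>

definition unit_point :: "(real ^ 'n::finite) set \<Rightarrow> ('k::field, 'n) vect" where
  "unit_point P = (\<lambda>\<xi>. if \<xi> \<in> Lam P then 1 else 0)"

lemma unit_point_in_cone: "(unit_point P :: ('k::field, 'n::finite) vect) \<in> affine_cone P"
proof -
  let ?t = "(\<chi> i. 1) :: 'k ^ 'n"
  have "proj_point (unit_point P :: ('k, 'n) vect) =
     proj_point (\<lambda>\<xi>. if \<xi> \<in> Lam P \<and> of_lat \<xi> \<in> P then character \<xi> ?t else 0)"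
    by (rule arg_cong[of _ _ proj_point]) (auto simp: fun_eq_iff unit_point_def Lam_def character_def)
  moreover have "?t \<in> torus" by (simp add: torus_def)
  ultimately have "proj_point (unit_point P :: ('k, 'n) vect) \<in> orbit P P" unfolding orbit_def by blast
  then show ?thesis
    using orbit_subset_X_face[of P P] by (auto simp: affine_cone_def toric_variety_def vspace_def unit_point_def)
qed

section \<open>Degrees and weights\<close>

text \<open>The next facts pin down the degree and the weight of a function by evaluating at the
  scalar \<open>2\<close>, which has infinite order in \<open>K\<^sup>*\<close> because \<open>K\<close> has characteristic zero.\<close>

lemma two_power_eq_iff:
  "(2 :: 'k::field_char_0) ^ a = 2 ^ b \<longleftrightarrow> a = b"
proof
  assume "(2 :: 'k) ^ a = 2 ^ b"
  then have "(of_nat (2 ^ a) :: 'k) = of_nat (2 ^ b)" by simp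
  then have "(2::nat) ^ a = 2 ^ b" using of_nat_eq_iff by blast
  then show "a = b" by simp
qed simp

lemma two_powi_eq_iff:
  "(2 :: 'k::field_char_0) powi a = 2 powi b \<longleftrightarrow> a = b"
proof
  assume eq: "(2 :: 'k) powi a = 2 powi b"
  obtain n :: nat where n: "0 \<le> a + int n" "0 \<le> b + int n"
    by (rule that[of "nat (\<bar>a\<bar> + \<bar>b\<bar>)"]) auto
  have "(2 :: 'k) powi (a + int n) = 2 powi (b + int n)"
    using eq by (simp add: power_int_add)
  then have "(2 :: 'k) ^ nat (a + int n) = 2 ^ nat (b + int n)"
    using n by (simp add: power_int_def)
  then show "a = b" using n by (simp add: two_power_eq_iff)
qed simp

text \<open>A homogeneous function of degree \<open>d\<close> is multiplied by \<open>2 ^ d\<close> when its argument is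
  doubled, and a nonzero function has a point where this determines \<open>d\<close>.\<close>

lemma graded_piece_degree_unique:
  fixes g :: "('k::field_char_0, 'n::finite) cfun"
  assumes "g \<in> graded_piece P d" "g \<in> graded_piece P e" "x \<in> affine_cone P" "g x \<noteq> 0"
  shows "d = e"
proof -
  have scale: "g (\<lambda>\<xi>. 2 * x \<xi>) = 2 ^ d * g x" if g: "g \<in> graded_piece P d" for d
  proof -
    obtain p where "p \<in> homogeneous_polynomials P d" "g = restrict (peval p) (affine_cone P)"
      using g by (auto simp: graded_piece_def)
    then show ?thesis
      using peval_scale[of p P d 2 x] affine_cone_scale[OF assms(3), of 2] assms(3) by simp
  qed
  then have "(2 :: 'k) ^ d = 2 ^ e" using assms by (metis mult_right_cancel)
  then show ?thesis by (simp add: two_power_eq_iff)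
qed

lemma deg_eqI:
  fixes g :: "('k::field_char_0, 'n::finite) cfun"
  assumes "g \<in> graded_piece P d" "x \<in> affine_cone P" "g x \<noteq> 0"
  shows "deg P g = d"
  unfolding deg_def using assms graded_piece_degree_unique by (intro the_equality) blast+

text \<open>Each coordinate of a weight is the exponent of 2 in the value of its character at
  the point with 2 in this coordinate and 1 in all the others.\<close>

lemma ext_character_inject:
  assumes "\<And>s. s \<in> ext_torus \<Longrightarrow> ext_character \<mu> s = (ext_character \<nu> s :: 'k::field_char_0)"
  shows "\<mu> = (\<nu> :: int \<times> (int ^ 'n::finite))"
proof -
  obtain a \<xi> b \<psi> where eqs: "\<mu> = (a, \<xi>)" "\<nu> = (b, \<psi>)" by (cases \<mu>, cases \<nu>)
  have "a = b"
    using assms[of "(2, \<chi> i. 1)"]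
    by (simp add: eqs ext_torus_def torus_def character_def two_powi_eq_iff)
  moreover have "\<xi> $ j = \<psi> $ j" for j
  proof -
    let ?t = "(\<chi> i. if i = j then 2 else 1) :: 'k ^ 'n"
    have char: "character \<zeta> ?t = 2 powi (\<zeta> $ j)" for \<zeta>
    proof -
      have "character \<zeta> ?t = (\<Prod>i\<in>UNIV. if i = j then 2 powi (\<zeta> $ i) else 1)"
        unfolding character_def by (intro prod.cong) auto
      then show ?thesis by simp
    qed
    show ?thesis
      using assms[of "(1, ?t)"] by (simp add: eqs ext_torus_def torus_def char two_powi_eq_iff)
  qed
  ultimately show ?thesis by (simp add: eqs vec_eq_iff)
qed

lemma weight_eqI:
  fixes g :: "('k::field_char_0, 'n::finite) cfun"
  assumes "has_weight P g \<mu>" "x \<in> affine_cone P" "g x \<noteq> 0"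
  shows "weight P g = \<mu>"
  unfolding weight_def
proof (rule the_equality)
  fix \<nu> assume \<nu>: "has_weight P g \<nu>"
  have "ext_character \<nu> s = (ext_character \<mu> s :: 'k)" if "s \<in> ext_torus" for s
  proof -
    have "restrict (\<lambda>x. ext_character \<nu> s * g x) (affine_cone P) x
        = restrict (\<lambda>x. ext_character \<mu> s * g x) (affine_cone P) x"
      using assms(1) \<nu> that unfolding has_weight_def by metis
    then show ?thesis using assms(2,3) by simp
  qed
  then show "\<nu> = \<mu>" by (rule ext_character_inject)
qed (rule assms(1))

section \<open>Eigenfunctions with a prescribed weight point\<close>

lemma of_lat_zero: "of_lat \<xi> = 0 \<longleftrightarrow> \<xi> = 0"
  by (simp add: of_lat_def vec_eq_iff)

text \<open>Induction on \<open>d\<close>, splitting off one lattice point of \<open>P\<close> at a time by normality. The weight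
  of the monomial is recorded by its value on the torus, where multiplying coordinates adds
  characters.\<close>

lemma normal_polytope_monomial:
  assumes "normal_polytope P" "\<mu> \<in> lattice_points d P"
  shows "\<exists>m. Poly_Mapping.keys m \<subseteq> Lam P \<and> monomial_degree m = d \<and>
    (\<forall>t \<in> torus. monomial_value m (\<lambda>\<xi>. character \<xi> t) = (character \<mu> t :: 'k::field))"
  using assms(2)
proof (induction d arbitrary: \<mu>)
  case 0
  then have "\<mu> = 0" by (auto simp: lattice_points_def of_lat_zero)
  then show ?case
    by (intro exI[of _ 0]) (simp add: monomial_degree_def monomial_value_zero character_zero)
next
  case (Suc d)
  then have "\<mu> \<in> lattice_points (d + 1) P" by simp
  then obtain \<xi> \<psi> where dec: "\<mu> = \<xi> + \<psi>" "\<xi> \<in> lattice_points d P" "\<psi> \<in> lattice_points 1 P"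
    using assms(1) unfolding normal_polytope_def by blast
  obtain m where m: "Poly_Mapping.keys m \<subseteq> Lam P" "monomial_degree m = d"
    "\<forall>t \<in> torus. monomial_value m (\<lambda>\<xi>. character \<xi> t) = (character \<xi> t :: 'k)"
    using Suc.IH[OF dec(2)] by blast
  have "\<psi> \<in> Lam P" using dec(3) by (auto simp: lattice_points_def Lam_def)
  then have "Poly_Mapping.keys (m + Poly_Mapping.single \<psi> 1) \<subseteq> Lam P"
    using m(1) keys_add[of m "Poly_Mapping.single \<psi> 1"] by auto
  moreover have "monomial_degree (m + Poly_Mapping.single \<psi> 1) = Suc d"
    unfolding monomial_degree_plus monomial_degree_single m(2) by simp
  moreover have "\<forall>t \<in> torus. monomial_value (m + Poly_Mapping.single \<psi> 1) (\<lambda>\<xi>. character \<xi> t)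
      = (character \<mu> t :: 'k)"
    unfolding monomial_value_plus monomial_value_single using m(3) character_plus dec(1) by metis
  ultimately show ?case by blast
qed

lemma lattice_point_eigenfunction:
  assumes "normal_polytope P" "\<mu> \<in> lattice_points d P"
  obtains f :: "('k::field_char_0, 'n::finite) cfun"
  where "eigenfunction P f" "deg P f = d" "weight P f = (- int d, - \<mu>)"
proof -
  obtain m where m: "Poly_Mapping.keys m \<subseteq> Lam P" "monomial_degree m = d"
    and char: "\<And>t. t \<in> torus \<Longrightarrow> monomial_value m (\<lambda>\<xi>. character \<xi> t) = (character \<mu> t :: 'k)"
    using normal_polytope_monomial[OF assms] by blast
  define p where "p = (Poly_Mapping.single m 1 :: ('k, 'n) polyn)"
  define f where "f = restrict (peval p) (affine_cone P)"
  have f_eq: "f x = monomial_value m x" if "x \<in> affine_cone P" for x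
    using that by (simp add: f_def p_def peval_single)
  have p: "p \<in> homogeneous_polynomials P d"
    using m unfolding p_def homogeneous_polynomials_def polynomials_def monomial_degree_def by simp
  have graded: "f \<in> graded_piece P d" unfolding graded_piece_def f_def using p by blast
  have ring: "f \<in> coord_ring P"
    using p unfolding coord_ring_def f_def homogeneous_polynomials_def by blast
  have "monomial_value m (unit_point P) = (1 :: 'k)"
    unfolding monomial_value_def using m(1) by (intro prod.neutral) (auto simp: unit_point_def)
  then have nonzero: "f (unit_point P) \<noteq> 0" by (simp add: f_eq unit_point_in_cone)
  have weight: "has_weight P f (- int d, - \<mu>)"
    unfolding has_weight_def act_fun_def
  proof (intro ballI restrict_ext)
    fix s :: "'k \<times> ('k ^ 'n)" and x :: "('k, 'n) vect"
    assume s: "s \<in> ext_torus" and x: "x \<in> affine_cone P"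
    obtain c t where ct: "s = (c, t)" by (cases s)
    then have t: "(\<chi> i. inverse (t $ i)) \<in> torus" using s by (simp add: ext_torus_def torus_def)
    have "f (act_vect (ext_inverse s) x) = monomial_value m (act_vect (ext_inverse s) x)"
      using f_eq affine_cone_act ext_inverse_in_ext_torus s x by blast
    also have "\<dots> = inverse c ^ d * character \<mu> (\<chi> i. inverse (t $ i)) * monomial_value m x"
      by (simp add: ct monomial_value_mult monomial_value_const m(2) char[OF t])
    also have "\<dots> = ext_character (- int d, - \<mu>) s * f x"
      by (simp add: ct f_eq[OF x] character_inverse power_int_minus power_inverse)
    finally show "f (act_vect (ext_inverse s) x) = ext_character (- int d, - \<mu>) s * f x" .
  qed
  have "f \<noteq> coord_zero P"
    using nonzero unit_point_in_cone by (metis coord_zero_def restrict_apply')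
  then have "eigenfunction P f" using ring weight unfolding eigenfunction_def by blast
  moreover have "deg P f = d" using deg_eqI[OF graded unit_point_in_cone nonzero] .
  moreover have "weight P f = (- int d, - \<mu>)"
    using weight_eqI[OF weight unit_point_in_cone nonzero] .
  ultimately show thesis by (rule that)
qed

lemma rational_point_common_denominator:
  fixes x :: "real ^ 'n::finite"
  assumes "rational_point x"
  obtains d \<mu> where "d \<ge> 1" "of_lat \<mu> = real d *\<^sub>R x"
proof -
  have "\<exists>q::nat. q \<ge> 1 \<and> real q * x $ i \<in> \<int>" for i
  proof -
    obtain a b where ab: "b > 0" "x $ i = of_int a / of_int b"
      using assms Rats_cases'[of "x $ i"] unfolding rational_point_def by metis
    then have "real (nat b) * x $ i = of_int a" by simp
    moreover have "nat b \<ge> 1" using ab(1) by simp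
    ultimately show ?thesis by (metis Ints_of_int)
  qed
  then obtain q where q: "\<And>i. q i \<ge> (1::nat)" "\<And>i. real (q i) * x $ i \<in> \<int>" by metis
  define d where "d = (\<Prod>i\<in>UNIV. q i)"
  have "real d * x $ i \<in> \<int>" for i
  proof -
    have "d = (\<Prod>j\<in>UNIV - {i}. q j) * q i" unfolding d_def by (simp add: prod.remove[of UNIV i])
    then have "real d * x $ i = real (\<Prod>j\<in>UNIV - {i}. q j) * (real (q i) * x $ i)" by simp
    also have "\<dots> \<in> \<int>" by (rule Ints_mult[OF Ints_of_nat q(2)])
    finally show ?thesis .
  qed
  then have "of_lat (\<chi> i. \<lfloor>real d * x $ i\<rfloor>) = real d *\<^sub>R x"
    by (simp add: of_lat_def vec_eq_iff)
  moreover have "d \<ge> 1" unfolding d_def using q(1) by (metis One_nat_def Suc_le_eq prod_pos less_eq_Suc_le)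
  ultimately show thesis using that by blast
qed

lemma rational_point_weight_point: "rational_point (snd (weight_point P g))"
  unfolding rational_point_def weight_point_def
  by (cases "weight P g") (auto simp: of_lat_def)

text \<open>If \<open>d x\<close> is a lattice point, it is a lattice point of \<open>dP\<close>, and the eigenfunction of degree
  \<open>d\<close> belonging to it has the weight point \<open>(1, x)\<close>.\<close>

lemma rational_point_eigenfunction:
  assumes "normal_polytope P" "x \<in> P" "rational_point x"
  obtains f :: "('k::field_char_0, 'n::finite) cfun"
  where "eigenfunction P f" "deg P f \<ge> 1" "weight_point P f = (1, x)"
proof -
  obtain d \<mu> where d: "d \<ge> 1" "of_lat \<mu> = real d *\<^sub>R x"
    by (rule rational_point_common_denominator[OF assms(3)])
  have "\<mu> \<in> lattice_points d P" using d(2) assms(2) unfolding lattice_points_def by blast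
  then obtain f :: "('k, 'n) cfun"
    where f: "eigenfunction P f" "deg P f = d" "weight P f = (- int d, - \<mu>)"
    by (rule lattice_point_eigenfunction[OF assms(1)])
  have "of_lat (- \<mu>) = - (real d *\<^sub>R x)" using d(2) by (simp add: of_lat_def vec_eq_iff)
  then have "weight_point P f = (1, x)" using d(1) f(2,3) by (simp add: weight_point_def)
  then show thesis using that f(1,2) d(1) by simp
qed

section \<open>The bijection\<close>

lemma bij_betw_quotient_invariant:
  assumes "equiv A r" and "\<And>x y. x \<in> A \<Longrightarrow> y \<in> A \<Longrightarrow> (x, y) \<in> r \<longleftrightarrow> f x = f y"
    and "f ` A = B"
  shows "bij_betw (\<lambda>c. the_elem (f ` c)) (A // r) B"
proof -
  have val: "the_elem (f ` (r `` {x})) = f x" if "x \<in> A" for x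
  proof -
    have "f y = f x" if "y \<in> r `` {x}" for y
      using assms(2)[OF \<open>x \<in> A\<close>, of y] equiv_type[OF assms(1)] that by auto
    moreover have "x \<in> r `` {x}" using equiv_class_self[OF assms(1) that] .
    ultimately have "f ` (r `` {x}) = {f x}" by blast
    then show ?thesis by simp
  qed
  show ?thesis
  proof (rule bij_betw_imageI)
    show "inj_on (\<lambda>c. the_elem (f ` c)) (A // r)"
    proof (rule inj_onI)
      fix c d assume cd: "c \<in> A // r" "d \<in> A // r" "the_elem (f ` c) = the_elem (f ` d)"
      obtain x y where xy: "x \<in> A" "y \<in> A" "c = r `` {x}" "d = r `` {y}"
        using cd(1,2) by (auto simp: quotient_def)
      then have "f x = f y" using cd(3) val by simp
      then have "(x, y) \<in> r" using assms(2)[OF xy(1,2)] by simp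
      then show "c = d" unfolding xy(3,4) by (rule equiv_class_eq[OF assms(1)])
    qed
    have "(\<lambda>c. the_elem (f ` c)) ` (A // r) = (\<lambda>x. the_elem (f ` (r `` {x}))) ` A"
      by (auto simp: quotient_def)
    also have "\<dots> = B" using val unfolding assms(3)[symmetric] by (intro image_cong) auto
    finally show "(\<lambda>c. the_elem (f ` c)) ` (A // r) = B" .
  qed
qed

definition stratification_points ::
  "(real ^ 'n::finite) set \<Rightarrow> ('k::field, 'n) stratification \<Rightarrow> (real ^ 'n) set \<Rightarrow> real ^ 'n" where
  "stratification_points P s = restrict (\<lambda>\<sigma>. snd (weight_point P (snd (s \<sigma>)))) (faces P)"

lemma seshadri_weight_point:
  assumes "s \<in> seshadri_stratifications P" "\<sigma> \<in> faces P"
  shows "weight_point P (snd (s \<sigma>)) \<in> {1} \<times> rel_interior \<sigma>"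
proof -
  have "\<forall>\<sigma> \<in> faces P. \<exists>f. s \<sigma> = (X_face P \<sigma>, f) \<and> eigenfunction P f \<and> deg P f \<ge> 1 \<and>
      weight_point P f \<in> {1} \<times> rel_interior \<sigma>"
    using assms(1) unfolding seshadri_stratifications_def by (elim CollectE conjE)
  from bspec[OF this assms(2)] show ?thesis by (elim exE conjE) simp
qed

text \<open>The first coordinate of the weight points is 1 for every stratification, so that the
  comparison of weight points reduces to their components in \<open>M\<^sub>R\<close>.\<close>

lemma stratification_equiv_iff:
  assumes "s \<in> seshadri_stratifications P" "s' \<in> seshadri_stratifications P"
  shows "(s, s') \<in> stratification_equiv P \<longleftrightarrow> stratification_points P s = stratification_points P s'"
proof -
  have "weight_point P (snd (s \<sigma>)) = weight_point P (snd (s' \<sigma>)) \<longleftrightarrow>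
      stratification_points P s \<sigma> = stratification_points P s' \<sigma>" if "\<sigma> \<in> faces P" for \<sigma>
    using seshadri_weight_point[OF assms(1) that] seshadri_weight_point[OF assms(2) that] that
    by (simp add: stratification_points_def mem_Times_iff prod_eq_iff)
  moreover have "stratification_points P s = stratification_points P s' \<longleftrightarrow>
      (\<forall>\<sigma> \<in> faces P. stratification_points P s \<sigma> = stratification_points P s' \<sigma>)"
    by (auto simp: stratification_points_def restrict_def fun_eq_iff)
  ultimately show ?thesis using assms by (simp add: stratification_equiv_def)
qed

lemma stratification_points_image:
  assumes "normal_polytope P"
  shows "stratification_points P `
      (seshadri_stratifications P :: ('k::field_char_0, 'n::finite) stratification set)
      = rational_face_points P"
proof
  show "stratification_points P `
      (seshadri_stratifications P :: ('k, 'n) stratification set) \<subseteq> rational_face_points P"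
  proof clarify
    fix s :: "('k, 'n) stratification" assume s: "s \<in> seshadri_stratifications P"
    show "stratification_points P s \<in> rational_face_points P"
      using seshadri_weight_point[OF s] rational_point_weight_point
      by (auto simp: stratification_points_def rational_face_points_def mem_Times_iff)
  qed
  show "rational_face_points P \<subseteq> stratification_points P `
      (seshadri_stratifications P :: ('k, 'n) stratification set)"
  proof
    fix v assume v: "v \<in> rational_face_points P"
    have "\<exists>f :: ('k, 'n) cfun. eigenfunction P f \<and> deg P f \<ge> 1 \<and> weight_point P f = (1, v \<sigma>)"
      if "\<sigma> \<in> faces P" for \<sigma>
    proof -
      have v\<sigma>: "v \<sigma> \<in> rel_interior \<sigma>" "rational_point (v \<sigma>)"
        using v that by (auto simp: rational_face_points_def)
      moreover have "\<sigma> \<subseteq> P" using that face_of_imp_subset by (auto simp: faces_def)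
      ultimately have "v \<sigma> \<in> P" using rel_interior_subset by blast
      then obtain g :: "('k, 'n) cfun"
        where "eigenfunction P g" "deg P g \<ge> 1" "weight_point P g = (1, v \<sigma>)"
        by (rule rational_point_eigenfunction[OF assms _ v\<sigma>(2)])
      then show ?thesis by blast
    qed
    then obtain f :: "(real ^ 'n) set \<Rightarrow> ('k, 'n) cfun" where
      f: "\<And>\<sigma>. \<sigma> \<in> faces P \<Longrightarrow> eigenfunction P (f \<sigma>) \<and> deg P (f \<sigma>) \<ge> 1 \<and> weight_point P (f \<sigma>) = (1, v \<sigma>)"
      by metis
    define s :: "('k, 'n) stratification" where
      "s = restrict (\<lambda>\<sigma>. (X_face P \<sigma>, f \<sigma>)) (faces P)"
    have "s \<in> seshadri_stratifications P"
      using f v by (auto simp: s_def seshadri_stratifications_def rational_face_points_def)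
    moreover have "stratification_points P s = v"
    proof (rule extensionalityI[of _ "faces P"])
      show "v \<in> extensional (faces P)" using v by (auto simp: rational_face_points_def PiE_def)
      show "stratification_points P s \<sigma> = v \<sigma>" if "\<sigma> \<in> faces P" for \<sigma>
        using f[OF that] that by (simp add: stratification_points_def s_def)
    qed (simp add: stratification_points_def)
    ultimately show "v \<in> stratification_points P `
        (seshadri_stratifications P :: ('k, 'n) stratification set)" by blast
  qed
qed

theorem theorem1:
  fixes P :: "(real ^ 'n::finite) set"
  assumes "lattice_polytope P"
    and "full_dimensional P"
    and "normal_polytope P"
  shows "\<exists>\<Phi>. bij_betw \<Phi>
           ((seshadri_stratifications P ::
               ('k::{alg_closed_field, field_char_0}, 'n) stratification set)
              // stratification_equiv P)
           (flag_triangulations P)"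
proof -
  let ?S = "seshadri_stratifications P :: ('k, 'n) stratification set"
  have "polytope P" using assms(1) unfolding lattice_polytope_def polytope_def by blast
  note tri = bij_betw_inv_into[OF flag_triangulations_bij[OF this]]
  have "bij_betw (\<lambda>c. the_elem (stratification_points P ` c)) (?S // stratification_equiv P)
      (rational_face_points P)"
    by (rule bij_betw_quotient_invariant[OF equiv_stratification_equiv])
      (simp_all add: stratification_equiv_iff stratification_points_image assms(3))
  from bij_betw_trans[OF this tri] show ?thesis by blast
qed

end
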